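(* Suppose Assumption 1 (stated in the context) holds, $p_1>\alpha$ and $p_2>1$. Let $E(\{S,T\})$ be a min-cut. Then for every $\sigma^*=({\sigma^1}^*,{\sigma^2}^* )\in\mathcal{S}_\Gamma$ and every $(i,j)\in E(\{S,T\})$, $$\mathbb{E}_{\sigma^*}[x_{ij}]=\frac{c_{ij}}{p_2}.$$ Furthermore, for every $({\sigma^1}^*,{\sigma^2}^* )\in\mathcal{S}_\Gamma$ such that every attack $\mu\in\operatorname{supp}({\sigma^2}^* )$ disrupts only edges of $E(\{S,T\})$, and for every $(i,j)\in E(\{S,T\})$, the probability under ${\sigma^2}^*$ that $(i,j)$ is disrupted, i.e. $\sum_{\mu\in\mathcal{A}:\mu_{ij}=1}{\sigma^2_\mu}^*$, equals $1-\frac{\alpha}{p_1}$.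
   Context: Network. $\mathcal{G}=(\mathcal{V},\mathcal{E})$ is a finite directed graph with source $s$ and destination $t\neq s$, having at least one $s$-$t$ path; each edge $(i,j)$ has a capacity $c_{ij}>0$ and a unit transportation cost $b_{ij}>0$. $\Lambda_{path}$ is the set of (simple directed) $s$-$t$ paths and $\Lambda$ is the set of all $s$-$t$ paths and all loops (simple directed cycles). A feasible flow $x$ is given by nonnegative amounts $(x_\lambda)_{\lambda\in\Lambda}$ whose edge flows $x_{ij}=\sum_{\lambda\in\Lambda:(i,j)\in\lambda}x_\lambda$ satisfy $x_{ij}\le c_{ij}$ for all $(i,j)\in\mathcal{E}$; $\mathcal{F}$ is the set of feasible flows. $F(x)=\sum_{\lambda\in\Lambda_{path}}x_\lambda$ is the amount of flow passing from $s$ to $t$, and $C_1(x)=\sum_{(i,j)\in\mathcal{E}}b_{ij}x_{ij}$. $\Theta=\max_{x\in\mathcal{F}}F(x)$. $\Omega$ is the set of maximum flows of minimum transportation cost, i.e. minimizers of $C_1$ over $\{x\in\mathcal{F}: F(x)=\Theta\}$. An $s$-$t$ cut is a partition $\{S,T\}$ of $\mathcal{V}$ with $s\in S$, $t\in T$; its cut-set is $E(\{S,T\})=\{(i,j)\in\mathcal{E}: i\in S, j\notin S\}$, its capacity is $\sum_{(i,j)\in E(\{S,T\})}c_{ij}$; a min-cut is a cut-set of an $s$-$t$ cut of minimum capacity. Attacks. $\mathcal{A}=\{0,1\}^{\mathcal{E}}$; $\mu_{ij}=1$ means edge $(i,j)$ is disrupted. $C_2(\mu)=\sum_{(i,j)\in\mathcal{E}}c_{ij}\mu_{ij}$.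 The effective flow $x^\mu$ has $x^\mu_\lambda=x_\lambda$ if $\lambda$ contains no disrupted edge and $x^\mu_\lambda=0$ otherwise; $F(x-x^\mu)=F(x)-F(x^\mu)$ is the lost flow. Game $\Gamma$. Player 1 chooses $x\in\mathcal{F}$ and player 2 simultaneously chooses $\mu\in\mathcal{A}$. With $p_1,p_2>0$, payoffs are $u_1(x,\mu)=p_1F(x^\mu)-C_1(x)$ and $u_2(x,\mu)=p_2F(x-x^\mu)-C_2(\mu)$. Mixed strategies: $\Delta(\mathcal{F})=\{\sigma^1\in[0,1]^{\mathcal{F}}:\sum_{x}\sigma^1_x=1\}$ and $\Delta(\mathcal{A})=\{\sigma^2\in[0,1]^{\mathcal{A}}:\sum_\mu\sigma^2_\mu=1\}$. For $\sigma=(\sigma^1,\sigma^2)$, $\mathbb{E}_\sigma[\varphi(x,\mu)]=\sum_x\sigma^1_x\sum_\mu\sigma^2_\mu\varphi(x,\mu)$ and $U_k(\sigma^1,\sigma^2)=\mathbb{E}_\sigma[u_k(x,\mu)]$. $\operatorname{supp}$ is the set of actions with positive probability. $\mathcal{S}_\Gamma$ is the set of mixed Nash equilibria: pairs $({\sigma^1}^*,{\sigma^2}^* )$ with $U_1({\sigma^1}^*,{\sigma^2}^* )\ge U_1(\sigma^1,{\sigma^2}^* )$ for all $\sigma^1\in\Delta(\mathcal{F})$ and $U_2({\sigma^1}^*,{\sigma^2}^* )\ge U_2({\sigma^1}^*,\sigma^2)$ for all $\sigma^2\in\Delta(\mathcal{A})$. Assumption 1. Let $\alpha=\min_{\lambda\in\Lambda_{path}}\sum_{(i,j)\in\lambda}b_{ij}$.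 There exists $x^*\in\Omega$ such that for every $\lambda\in\Lambda_{path}$, $x^*_\lambda>0$ implies $\sum_{(i,j)\in\lambda}b_{ij}=\alpha$. *)

theory Defs
  imports "HOL-Probability.Probability" "Graph_Theory.Pair_Digraph"
begin

section \<open>Paths, loops and flows\<close>

text \<open>
  Simple paths and simple cycles are represented by their sets of edges. A simple path or
  cycle is determined by this set; for cycles it identifies the arc lists that differ only in
  the starting vertex. As the source differs from the sink, no set is both a path and a loop.
\<close>

type_synonym 'a edge = "'a \<times> 'a"
type_synonym 'a flow = "'a edge set \<Rightarrow> real"
type_synonym 'a attack = "'a edge \<Rightarrow> real"

definition st_paths :: "'a pair_pre_digraph \<Rightarrow> 'a \<Rightarrow> 'a \<Rightarrow> 'a edge set set" where
  "st_paths G s t = {set p | p. pre_digraph.apath (with_proj G) s p t}"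

definition loops :: "'a pair_pre_digraph \<Rightarrow> 'a edge set set" where
  "loops G = {set p | p. pre_digraph.cycle (with_proj G) p}"

definition paths_loops :: "'a pair_pre_digraph \<Rightarrow> 'a \<Rightarrow> 'a \<Rightarrow> 'a edge set set" where
  "paths_loops G s t = st_paths G s t \<union> loops G"

definition edge_flow :: "'a pair_pre_digraph \<Rightarrow> 'a \<Rightarrow> 'a \<Rightarrow> 'a flow \<Rightarrow> 'a edge \<Rightarrow> real" where
  "edge_flow G s t x e = (\<Sum>l\<in>{l \<in> paths_loops G s t. e \<in> l}. x l)"

definition feasible_flows ::
    "'a pair_pre_digraph \<Rightarrow> 'a \<Rightarrow> 'a \<Rightarrow> ('a edge \<Rightarrow> real) \<Rightarrow> 'a flow set" where
  "feasible_flows G s t c =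
     {x \<in> paths_loops G s t \<rightarrow>\<^sub>E {0..}. \<forall>e\<in>parcs G. edge_flow G s t x e \<le> c e}"

definition flow_value :: "'a pair_pre_digraph \<Rightarrow> 'a \<Rightarrow> 'a \<Rightarrow> 'a flow \<Rightarrow> real" where
  "flow_value G s t x = (\<Sum>l\<in>st_paths G s t. x l)"

definition transport_cost ::
    "'a pair_pre_digraph \<Rightarrow> 'a \<Rightarrow> 'a \<Rightarrow> ('a edge \<Rightarrow> real) \<Rightarrow> 'a flow \<Rightarrow> real" where
  "transport_cost G s t b x = (\<Sum>e\<in>parcs G. b e * edge_flow G s t x e)"

definition max_flow_value ::
    "'a pair_pre_digraph \<Rightarrow> 'a \<Rightarrow> 'a \<Rightarrow> ('a edge \<Rightarrow> real) \<Rightarrow> real" where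
  "max_flow_value G s t c = (GREATEST v. v \<in> flow_value G s t ` feasible_flows G s t c)"

definition min_cost_max_flows ::
    "'a pair_pre_digraph \<Rightarrow> 'a \<Rightarrow> 'a \<Rightarrow> ('a edge \<Rightarrow> real) \<Rightarrow> ('a edge \<Rightarrow> real) \<Rightarrow> 'a flow set" where
  "min_cost_max_flows G s t c b =
     {x. is_arg_min (transport_cost G s t b)
           (\<lambda>y. y \<in> feasible_flows G s t c \<and> flow_value G s t y = max_flow_value G s t c) x}"

definition min_path_cost ::
    "'a pair_pre_digraph \<Rightarrow> 'a \<Rightarrow> 'a \<Rightarrow> ('a edge \<Rightarrow> real) \<Rightarrow> real" where
  "min_path_cost G s t b = Min ((\<lambda>l. \<Sum>e\<in>l. b e) ` st_paths G s t)"

definition min_cost_paths_assumption ::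
    "'a pair_pre_digraph \<Rightarrow> 'a \<Rightarrow> 'a \<Rightarrow> ('a edge \<Rightarrow> real) \<Rightarrow> ('a edge \<Rightarrow> real) \<Rightarrow> bool" where
  "min_cost_paths_assumption G s t c b \<longleftrightarrow>
     (\<exists>x\<in>min_cost_max_flows G s t c b. \<forall>l\<in>st_paths G s t.
        x l > 0 \<longrightarrow> (\<Sum>e\<in>l. b e) = min_path_cost G s t b)"

section \<open>Cuts\<close>

definition st_cut :: "'a pair_pre_digraph \<Rightarrow> 'a \<Rightarrow> 'a \<Rightarrow> 'a set \<times> 'a set \<Rightarrow> bool" where
  "st_cut G s t = (\<lambda>(S, T). S \<union> T = pverts G \<and> S \<inter> T = {} \<and> s \<in> S \<and> t \<in> T)"

definition cut_set :: "'a pair_pre_digraph \<Rightarrow> 'a set \<times> 'a set \<Rightarrow> 'a edge set" where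
  "cut_set G = (\<lambda>(S, T). {(i, j). (i, j) \<in> parcs G \<and> i \<in> S \<and> j \<notin> S})"

definition min_st_cut ::
    "'a pair_pre_digraph \<Rightarrow> 'a \<Rightarrow> 'a \<Rightarrow> ('a edge \<Rightarrow> real) \<Rightarrow> 'a set \<times> 'a set \<Rightarrow> bool" where
  "min_st_cut G s t c = is_arg_min (\<lambda>C. \<Sum>e\<in>cut_set G C. c e) (st_cut G s t)"

section \<open>Attacks\<close>

definition attacks :: "'a pair_pre_digraph \<Rightarrow> 'a attack set" where
  "attacks G = parcs G \<rightarrow>\<^sub>E {0, 1}"

definition attack_cost ::
    "'a pair_pre_digraph \<Rightarrow> ('a edge \<Rightarrow> real) \<Rightarrow> 'a attack \<Rightarrow> real" where
  "attack_cost G c \<mu> = (\<Sum>e\<in>parcs G. c e * \<mu> e)"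

definition effective_flow ::
    "'a pair_pre_digraph \<Rightarrow> 'a \<Rightarrow> 'a \<Rightarrow> 'a flow \<Rightarrow> 'a attack \<Rightarrow> 'a flow" where
  "effective_flow G s t x \<mu> =
     (\<lambda>l\<in>paths_loops G s t. if \<exists>e\<in>l. \<mu> e = 1 then 0 else x l)"

section \<open>The game\<close>

definition payoff1 ::
    "'a pair_pre_digraph \<Rightarrow> 'a \<Rightarrow> 'a \<Rightarrow> ('a edge \<Rightarrow> real) \<Rightarrow> real \<Rightarrow> 'a flow \<Rightarrow> 'a attack \<Rightarrow> real" where
  "payoff1 G s t b p1 x \<mu> =
     p1 * flow_value G s t (effective_flow G s t x \<mu>) - transport_cost G s t b x"

definition payoff2 ::
    "'a pair_pre_digraph \<Rightarrow> 'a \<Rightarrow> 'a \<Rightarrow> ('a edge \<Rightarrow> real) \<Rightarrow> real \<Rightarrow> 'a flow \<Rightarrow> 'a attack \<Rightarrow> real" where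
  "payoff2 G s t c p2 x \<mu> =
     p2 * flow_value G s t (\<lambda>l. x l - effective_flow G s t x \<mu> l) - attack_cost G c \<mu>"

text \<open>
  A nonnegative family of reals over an arbitrary index set that sums to 1 has countable
  support, so it is the same thing as a \<^typ>\<open>'b pmf\<close> supported in that set.
\<close>

definition mixed_strategies :: "'b set \<Rightarrow> 'b pmf set" where
  "mixed_strategies X = {\<sigma>. set_pmf \<sigma> \<subseteq> X}"

definition expect :: "'b pmf \<Rightarrow> 'c pmf \<Rightarrow> ('b \<Rightarrow> 'c \<Rightarrow> real) \<Rightarrow> real" where
  "expect \<sigma>1 \<sigma>2 f =
     measure_pmf.expectation \<sigma>1 (\<lambda>x. measure_pmf.expectation \<sigma>2 (\<lambda>\<mu>. f x \<mu>))"

definition nash_equilibria ::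
    "'a pair_pre_digraph \<Rightarrow> 'a \<Rightarrow> 'a \<Rightarrow> ('a edge \<Rightarrow> real) \<Rightarrow> ('a edge \<Rightarrow> real) \<Rightarrow> real \<Rightarrow> real
     \<Rightarrow> ('a flow pmf \<times> 'a attack pmf) set" where
  "nash_equilibria G s t c b p1 p2 =
     {(\<sigma>1, \<sigma>2).
        \<sigma>1 \<in> mixed_strategies (feasible_flows G s t c) \<and>
        \<sigma>2 \<in> mixed_strategies (attacks G) \<and>
        (\<forall>\<tau>1\<in>mixed_strategies (feasible_flows G s t c).
           expect \<sigma>1 \<sigma>2 (payoff1 G s t b p1) \<ge> expect \<tau>1 \<sigma>2 (payoff1 G s t b p1)) \<and>
        (\<forall>\<tau>2\<in>mixed_strategies (attacks G).
           expect \<sigma>1 \<sigma>2 (payoff2 G s t c p2) \<ge> expect \<sigma>1 \<tau>2 (payoff2 G s t c p2))}"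

end

theory Submission
  imports Defs
begin

text \<open>
  Adding to each payoff a function of the opponent's action turns the game into a zero-sum game.
  Let \<open>y\<close> be a maximum flow along cheapest paths and \<open>\<theta>\<close> its value, which is the capacity of
  the given minimum cut. Routing \<open>y\<close> with probability \<open>1 / p2\<close> and nothing otherwise, against
  attacking the whole cut with probability \<open>1 - \<alpha> / p1\<close> and nothing otherwise, is a saddle
  point. Any equilibrium is interchangeable with this one, so these four pure actions are best
  replies to it. Comparing them with attacks on single edges of the cut and with the flow that
  \<open>y\<close> sends along a single path gives one inequality per edge of the cut; summed over the cut
  they are equalities, hence each of them is.
\<close>

section \<open>Path flows matching a minimum cut\<close>

locale st_digraph = pair_fin_digraph G for G :: "'a pair_pre_digraph" +
  fixes s t :: 'a
  assumes source: "s \<in> pverts G" and sink: "t \<in> pverts G" and sink_neq_source: "t \<noteq> s"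
begin

abbreviation "paths \<equiv> st_paths G s t"

section \<open>Cuts and the paths crossing them\<close>

definition cuts :: "'a set set" where
  "cuts = {S. S \<subseteq> pverts G \<and> s \<in> S \<and> t \<notin> S}"

definition boundary :: "'a set \<Rightarrow> 'a edge set" where
  "boundary S = {e \<in> parcs G. fst e \<in> S \<and> snd e \<notin> S}"

lemma finite_cuts: "finite cuts"
  unfolding cuts_def using pair_finite_verts by (auto intro: finite_subset[of _ "Pow (pverts G)"])

lemma source_cut: "{s} \<in> cuts"
  using source sink_neq_source by (auto simp: cuts_def)

lemma boundary_subset: "boundary S \<subseteq> parcs G"
  by (auto simp: boundary_def)

lemma finite_boundary: "finite (boundary S)"
  using boundary_subset pair_finite_arcs by (rule finite_subset)

lemma st_path_subset: "l \<in> paths \<Longrightarrow> l \<subseteq> parcs G"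
  by (auto simp: st_paths_def apath_def awalk_def)

lemma st_path_nonempty: "l \<in> paths \<Longrightarrow> l \<noteq> {}"
  using sink_neq_source by (auto simp: st_paths_def apath_Nil_iff)

lemma finite_st_path: "l \<in> paths \<Longrightarrow> finite l"
  by (auto simp: st_paths_def)

lemma finite_st_paths: "finite paths"
  using pair_finite_arcs by (rule finite_subset[rotated, OF finite_Pow_iff[THEN iffD2]])
    (auto dest: st_path_subset)

text \<open>The sum telescopes along the arc list; passing to the edge set loses nothing because a
  simple path repeats no arc. With the indicator of a cut as \<open>f\<close> it counts forward
  minus backward crossings.\<close>

lemma sum_st_path_potential:
  fixes f :: "'a \<Rightarrow> real"
  assumes "l \<in> paths"
  shows "(\<Sum>e\<in>l. f (fst e) - f (snd e)) = f s - f t"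
proof -
  obtain p where p: "apath s p t" and l: "l = set p"
    using assms by (auto simp: st_paths_def)
  have telescope: "(\<Sum>e\<leftarrow>p. f (fst e) - f (snd e)) = f u - f v" if "awalk u p v" for u v
    using that by (induction p arbitrary: u) (auto simp: awalk_simps)
  have "distinct p"
    using p distinct_verts_imp_distinct by (auto simp: apath_def)
  then show ?thesis
    using telescope[of s t] p by (simp add: l apath_def sum_list_distinct_conv_sum_set)
qed

text \<open>Forward crossings exceed backward ones by exactly 1, and \<open>forward\<close> excludes
  the backward ones.\<close>

lemma card_path_boundary:
  assumes l: "l \<in> paths" and S: "S \<in> cuts"
    and forward: "\<And>e. e \<in> l \<Longrightarrow> snd e \<in> S \<Longrightarrow> fst e \<in> S"
  shows "card (l \<inter> boundary S) = 1"
proof -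
  have "real (card (l \<inter> boundary S)) = (\<Sum>e\<in>l. if e \<in> boundary S then 1 else 0)"
    using finite_st_path[OF l] by (simp add: sum.If_cases Int_def)
  also have "\<dots> = (\<Sum>e\<in>l. indicator S (fst e) - indicator S (snd e))"
    using forward st_path_subset[OF l]
    by (intro sum.cong) (auto simp: boundary_def indicator_def)
  also have "\<dots> = 1"
    using S by (simp add: sum_st_path_potential[OF l] cuts_def)
  finally show ?thesis by simp
qed

text \<open>Without a forward crossing every term of the telescoping sum is at most 0, although the
  sum is 1.\<close>

lemma path_meets_boundary:
  assumes l: "l \<in> paths" and S: "S \<in> cuts"
  shows "l \<inter> boundary S \<noteq> {}"
proof
  assume "l \<inter> boundary S = {}"
  then have "(\<Sum>e\<in>l. indicator S (fst e) - indicator S (snd e)) \<le> (0::real)"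
    using st_path_subset[OF l]
    by (intro sum_nonpos) (auto simp: boundary_def indicator_def)
  then show False
    using S by (simp add: sum_st_path_potential[OF l] cuts_def)
qed

text \<open>No edge of positive capacity leaves the set \<open>R\<close> of vertices reachable
  through such edges, so \<open>R\<close> cannot be a cut and must contain \<open>t\<close>.\<close>

lemma st_path_in_positive_part:
  fixes c :: "'a edge \<Rightarrow> real"
  assumes pos: "\<And>S. S \<in> cuts \<Longrightarrow> sum c (boundary S) > 0"
  obtains l where "l \<in> paths" "\<And>e. e \<in> l \<Longrightarrow> c e > 0"
proof -
  define R where "R = {v \<in> pverts G. \<exists>p. awalk s p v \<and> (\<forall>e\<in>set p. c e > 0)}"
  have "sum c (boundary R) \<le> 0"
  proof (rule sum_nonpos, rule ccontr)
    fix e assume e: "e \<in> boundary R" and "\<not> c e \<le> 0"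
    then obtain p where p: "awalk s p (fst e)" "\<forall>e\<in>set p. c e > 0"
      by (auto simp: boundary_def R_def)
    have "awalk (fst e) [e] (snd e)"
      using e arc_snd_in_verts by (auto simp: boundary_def awalk_simps)
    with p(1) have "awalk s (p @ [e]) (snd e)" by (rule awalk_appendI)
    then have "snd e \<in> R"
      using p(2) \<open>\<not> c e \<le> 0\<close> e arc_snd_in_verts
      unfolding R_def boundary_def by (intro CollectI conjI exI[of _ "p @ [e]"]) auto
    with e show False by (auto simp: boundary_def)
  qed
  moreover have "s \<in> R"
    using source unfolding R_def by (intro CollectI conjI exI[of _ "[]"]) (auto simp: awalk_simps)
  ultimately have "t \<in> R"
    using pos[of R] by (force simp: cuts_def R_def)
  then obtain p where p: "awalk s p t" "\<forall>e\<in>set p. c e > 0"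
    by (auto simp: R_def)
  have "set (awalk_to_apath p) \<in> paths"
    using apath_awalk_to_apath[OF p(1)] by (auto simp: st_paths_def)
  then show thesis
    using that awalk_to_apath_subset[OF p(1)] p(2) by blast
qed

text \<open>Submodularity of the cut capacity: the edge is counted for neither \<open>A \<inter> B\<close> nor \<open>A \<union> B\<close>.\<close>

lemma no_backward_edge_over_min_cut:
  fixes c :: "'a edge \<Rightarrow> real"
  assumes nonneg: "\<And>e. e \<in> parcs G \<Longrightarrow> c e \<ge> 0"
    and v: "\<And>S. S \<in> cuts \<Longrightarrow> v \<le> sum c (boundary S)"
    and A: "A \<in> cuts" "sum c (boundary A) = v"
    and B: "B \<in> cuts" "sum c (boundary B) = v"
    and e: "e \<in> boundary B" "c e > 0" "snd e \<in> A"
  shows "fst e \<in> A"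
proof (rule ccontr)
  assume backward: "fst e \<notin> A"
  \<comment> \<open>Cut capacities become sums over all edges, so that submodularity can be checked
    edge by edge; the inequality is strict at \<open>e\<close>.\<close>
  define w where "w S f = (if f \<in> boundary S then c f else 0)" for S f
  have sum_w: "sum c (boundary S) = (\<Sum>f\<in>parcs G. w S f)" for S
    using boundary_subset[of S] pair_finite_arcs
    by (simp add: w_def sum.If_cases Int_absorb1)
  have "(\<Sum>f\<in>parcs G. w (A \<inter> B) f + w (A \<union> B) f) < (\<Sum>f\<in>parcs G. w A f + w B f)"
  proof (rule sum_strict_mono_ex1)
    show "\<forall>f\<in>parcs G. w (A \<inter> B) f + w (A \<union> B) f \<le> w A f + w B f"
      using nonneg by (auto simp: w_def boundary_def)
    show "\<exists>f\<in>parcs G. w (A \<inter> B) f + w (A \<union> B) f < w A f + w B f"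
      using e backward by (intro bexI[of _ e]) (auto simp: w_def boundary_def)
  qed (rule pair_finite_arcs)
  moreover have "A \<inter> B \<in> cuts" "A \<union> B \<in> cuts"
    using A B by (auto simp: cuts_def)
  ultimately show False
    using v[of "A \<inter> B"] v[of "A \<union> B"] A B by (simp add: sum_w sum.distrib)
qed

section \<open>Building a flow by lowering capacities\<close>

definition positive_edges :: "('a edge \<Rightarrow> real) \<Rightarrow> 'a edge set" where
  "positive_edges c = {e \<in> parcs G. c e > 0}"

text \<open>When \<open>v\<close> is the minimum cut capacity these are the cuts that are not
  minimum. Their number plus the number of positive edges is the induction measure below.\<close>

definition slack_cuts :: "('a edge \<Rightarrow> real) \<Rightarrow> real \<Rightarrow> 'a set set" where
  "slack_cuts c v = {S \<in> cuts. sum c (boundary S) > v}"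

text \<open>
  Capacities are lowered uniformly on \<open>D\<close> until an edge of \<open>D\<close> vanishes or a further cut
  becomes minimal. It is applied with \<open>a = 0\<close> to an edge that lies in no minimum cut, and with
  \<open>a = 1\<close> to a path once every edge of positive capacity lies in some minimum cut; such a path
  crosses each minimum cut exactly once.
\<close>

lemma reduce_capacities:
  fixes c :: "'a edge \<Rightarrow> real" and v :: real and a :: nat
  assumes nonneg: "\<And>e. e \<in> parcs G \<Longrightarrow> c e \<ge> 0"
    and v: "\<And>S. S \<in> cuts \<Longrightarrow> v \<le> sum c (boundary S)"
    and M: "M \<in> cuts" "sum c (boundary M) = v"
    and D: "D \<subseteq> positive_edges c" "D \<noteq> {}"
    and cross: "\<And>S. S \<in> cuts \<Longrightarrow> sum c (boundary S) = v \<Longrightarrow> card (D \<inter> boundary S) = a"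
  obtains \<delta> :: real and c' :: "'a edge \<Rightarrow> real"
  where "\<delta> > 0" "c' = (\<lambda>e. if e \<in> D then c e - \<delta> else c e)"
    "\<forall>e\<in>parcs G. c' e \<ge> 0"
    "\<forall>S\<in>cuts. v - a * \<delta> \<le> sum c' (boundary S)"
    "sum c' (boundary M) = v - a * \<delta>"
    "card (positive_edges c') + card (slack_cuts c' (v - a * \<delta>))
       < card (positive_edges c) + card (slack_cuts c v)"
proof -
  \<comment> \<open>Lowering by \<delta> costs the cut \<open>S\<close> an amount
    \<open>k S * \<delta>\<close>, while the target value falls by \<open>a * \<delta>\<close>. Only
    cuts with \<open>k S > a\<close> lose ground, and they stay above the target as long as \<delta>
    is at most \<open>r S\<close>. So \<open>X\<close> collects all upper bounds on
    \<delta>.\<close>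
  define k where "k S = card (D \<inter> boundary S)" for S
  define r where "r S = (sum c (boundary S) - v) / (real (k S) - real a)" for S
  define X where "X = c ` D \<union> r ` {S \<in> cuts. k S > a}"
  define \<delta> where "\<delta> = Min X"
  define c' where "c' = (\<lambda>e. if e \<in> D then c e - \<delta> else c e)"
  have DE: "D \<subseteq> parcs G" "finite D"
    using D finite_subset[OF _ pair_finite_arcs] unfolding positive_edges_def by blast+
  have X: "finite X" "X \<noteq> {}"
    using D DE finite_cuts by (auto simp: X_def)
  have r_pos: "r S > 0" if "S \<in> cuts" "k S > a" for S
  proof -
    have "sum c (boundary S) \<noteq> v" using cross[of S] that by (auto simp: k_def)
    then show ?thesis using v[of S] that by (simp add: r_def)
  qed
  then have \<delta>_pos: "\<delta> > 0"
    using D X unfolding \<delta>_def by (subst Min_gr_iff) (auto simp: X_def positive_edges_def)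
  have \<delta>_le_c: "\<delta> \<le> c e" if "e \<in> D" for e
    unfolding \<delta>_def using X that by (intro Min_le) (auto simp: X_def)
  have \<delta>_le_r: "\<delta> \<le> r S" if "S \<in> cuts" "k S > a" for S
    unfolding \<delta>_def using X that by (intro Min_le) (auto simp: X_def)
  have sum_c': "sum c' (boundary S) = sum c (boundary S) - k S * \<delta>" for S
  proof -
    have "sum c' (boundary S) = (\<Sum>e\<in>boundary S. c e - (if e \<in> D then \<delta> else 0))"
      by (intro sum.cong) (auto simp: c'_def)
    also have "\<dots> = sum c (boundary S) - k S * \<delta>"
      using finite_boundary
      by (simp add: sum_subtractf sum.If_cases k_def Int_commute flip: Int_def)
    finally show ?thesis .
  qed
  have nonneg': "c' e \<ge> 0" if "e \<in> parcs G" for e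
    using nonneg that \<delta>_le_c by (auto simp: c'_def)
  have v': "v - a * \<delta> \<le> sum c' (boundary S)" if S: "S \<in> cuts" for S
  proof (cases "k S > a")
    case True
    then have "(real (k S) - a) * \<delta> \<le> sum c (boundary S) - v"
      using \<delta>_le_r[OF S] by (simp add: r_def field_simps)
    then show ?thesis by (simp add: sum_c' algebra_simps)
  next
    case False
    then have "k S * \<delta> \<le> a * \<delta>" using \<delta>_pos by simp
    with v[OF S] show ?thesis by (simp add: sum_c')
  qed
  have M': "sum c' (boundary M) = v - a * \<delta>"
    using M cross by (simp add: sum_c' k_def)
  have positive_subset: "positive_edges c' \<subseteq> positive_edges c"
    using \<delta>_pos by (auto simp: positive_edges_def c'_def split: if_splits)
  \<comment> \<open>A minimum cut loses exactly \<open>a * \<delta>\<close> by \<open>cross\<close>,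
    so it stays minimum.\<close>
  have slack_subset: "slack_cuts c' (v - a * \<delta>) \<subseteq> slack_cuts c v"
  proof
    fix S assume S: "S \<in> slack_cuts c' (v - a * \<delta>)"
    then have "sum c (boundary S) \<noteq> v"
      using cross[of S] by (auto simp: slack_cuts_def sum_c' k_def)
    with S v[of S] show "S \<in> slack_cuts c v" by (auto simp: slack_cuts_def)
  qed
  have fin: "finite (positive_edges c)" "finite (slack_cuts c v)"
    using pair_finite_arcs finite_cuts by (auto simp: positive_edges_def slack_cuts_def)
  have "\<delta> \<in> X" unfolding \<delta>_def using X by (rule Min_in)
  \<comment> \<open>The bound that attains the minimum shows what shrinks: an edge whose capacity
    drops to 0, or a cut that becomes minimum.\<close>
  then consider e where "e \<in> D" "\<delta> = c e" | S where "S \<in> cuts" "k S > a" "\<delta> = r S"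
    by (auto simp: X_def)
  then have decrease: "positive_edges c' \<subset> positive_edges c \<or>
      slack_cuts c' (v - a * \<delta>) \<subset> slack_cuts c v"
  proof cases
    case 1
    then have "e \<in> positive_edges c - positive_edges c'"
      using D by (auto simp: positive_edges_def c'_def)
    with positive_subset show ?thesis by blast
  next
    case 2
    then have "(real (k S) - a) * \<delta> = sum c (boundary S) - v"
      by (simp add: r_def)
    then have "sum c' (boundary S) = v - a * \<delta>"
      by (simp add: sum_c' algebra_simps)
    moreover have "sum c (boundary S) > v"
      using r_pos 2 by (simp add: r_def zero_less_divide_iff)
    ultimately have "S \<in> slack_cuts c v - slack_cuts c' (v - a * \<delta>)"
      using 2 by (auto simp: slack_cuts_def)
    with slack_subset show ?thesis by blast
  qed
  have "card (positive_edges c') + card (slack_cuts c' (v - a * \<delta>))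
       < card (positive_edges c) + card (slack_cuts c v)"
    using decrease
  proof
    assume "positive_edges c' \<subset> positive_edges c"
    from psubset_card_mono[OF fin(1) this] card_mono[OF fin(2) slack_subset]
    show ?thesis by linarith
  next
    assume "slack_cuts c' (v - a * \<delta>) \<subset> slack_cuts c v"
    from psubset_card_mono[OF fin(2) this] card_mono[OF fin(1) positive_subset]
    show ?thesis by linarith
  qed
  with \<delta>_pos c'_def nonneg' v' M' show thesis by (intro that[of \<delta> c']) auto
qed

text \<open>The hard half of max-flow min-cut, for weights on paths. A positive edge outside every
  minimum cut is lowered with \<open>v\<close> unchanged; once there is none, \<delta> units are
  sent along a path and \<open>v\<close> drops by \<delta>. Both moves decrease the measure.\<close>

lemma path_flow_of_min_cut_value:
  fixes c :: "'a edge \<Rightarrow> real" and v :: real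
  assumes "\<And>e. e \<in> parcs G \<Longrightarrow> c e \<ge> 0"
    and "\<And>S. S \<in> cuts \<Longrightarrow> v \<le> sum c (boundary S)"
    and "M \<in> cuts" "sum c (boundary M) = v"
  shows "\<exists>x :: 'a flow. (\<forall>l. x l \<ge> 0) \<and> (\<forall>e\<in>parcs G. (\<Sum>l | l \<in> paths \<and> e \<in> l. x l) \<le> c e) \<and>
    sum x paths = v"
  using assms
proof (induction "card (positive_edges c) + card (slack_cuts c v)" arbitrary: c v
    rule: less_induct)
  case less
  note nonneg = less.prems(1) and v = less.prems(2) and M = less.prems(3,4)
  let ?min = "\<lambda>S. S \<in> cuts \<and> sum c (boundary S) = v"
  have "v \<ge> 0"
    using M(2) sum_nonneg[of "boundary M" c] nonneg boundary_subset by blast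
  show ?case
  proof (cases "v = 0")
    case True
    then show ?thesis using nonneg by (intro exI[of _ "\<lambda>_. 0"]) auto
  next
    case False
    show ?thesis
    proof (cases "\<forall>e\<in>positive_edges c. \<exists>S. ?min S \<and> e \<in> boundary S")
      case False
      then obtain e where e: "e \<in> positive_edges c" "\<And>S. ?min S \<Longrightarrow> e \<notin> boundary S"
        by auto
      then have D: "{e} \<subseteq> positive_edges c" "{e} \<noteq> {}"
          "\<And>S. S \<in> cuts \<Longrightarrow> sum c (boundary S) = v \<Longrightarrow> card ({e} \<inter> boundary S) = 0"
        by auto
      obtain \<delta> c' where \<delta>: "\<delta> > 0" and c': "c' = (\<lambda>f. if f \<in> {e} then c f - \<delta> else c f)"
        and IH_prems: "\<forall>e\<in>parcs G. c' e \<ge> 0"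
          "\<forall>S\<in>cuts. v - real 0 * \<delta> \<le> sum c' (boundary S)"
          "sum c' (boundary M) = v - real 0 * \<delta>"
          "card (positive_edges c') + card (slack_cuts c' (v - real 0 * \<delta>))
             < card (positive_edges c) + card (slack_cuts c v)"
        by (rule reduce_capacities[OF nonneg v M D])
      have le: "c' f \<le> c f" for f using \<delta> by (simp add: c')
      obtain x where x: "\<forall>l. x l \<ge> 0"
          "\<forall>e\<in>parcs G. (\<Sum>l | l \<in> paths \<and> e \<in> l. x l) \<le> c' e" "sum x paths = v"
        using less.hyps[of c' v] IH_prems M(1) by auto
      have "\<forall>e\<in>parcs G. (\<Sum>l | l \<in> paths \<and> e \<in> l. x l) \<le> c e"
        using x(2) le order_trans by blast
      with x(1,3) show ?thesis by blast
    next
      case True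
      have "sum c (boundary S) > 0" if "S \<in> cuts" for S
        using v[OF that] \<open>v \<ge> 0\<close> \<open>v \<noteq> 0\<close> by linarith
      then obtain l where l: "l \<in> paths" "\<And>e. e \<in> l \<Longrightarrow> c e > 0"
        using st_path_in_positive_part by blast
      have l_sub: "l \<subseteq> positive_edges c"
        using l st_path_subset by (auto simp: positive_edges_def)
      \<comment> \<open>Each edge of \<open>l\<close> leaves some minimum cut \<open>B\<close>, so
        by uncrossing \<open>B\<close> with \<open>S\<close> it cannot enter \<open>S\<close> from
        outside.\<close>
      have cross: "card (l \<inter> boundary S) = 1" if S: "S \<in> cuts" "sum c (boundary S) = v" for S
      proof (rule card_path_boundary[OF l(1) S(1)])
        fix e assume e: "e \<in> l" "snd e \<in> S"
        then obtain B where "?min B" "e \<in> boundary B"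
          using True l_sub by blast
        then show "fst e \<in> S"
          using no_backward_edge_over_min_cut[of c v S B e] nonneg v S e l(2) by blast
      qed
      obtain \<delta> c' where \<delta>: "\<delta> > 0" and c': "c' = (\<lambda>f. if f \<in> l then c f - \<delta> else c f)"
        and IH_prems: "\<forall>e\<in>parcs G. c' e \<ge> 0"
          "\<forall>S\<in>cuts. v - real 1 * \<delta> \<le> sum c' (boundary S)"
          "sum c' (boundary M) = v - real 1 * \<delta>"
          "card (positive_edges c') + card (slack_cuts c' (v - real 1 * \<delta>))
             < card (positive_edges c) + card (slack_cuts c v)"
        by (rule reduce_capacities[OF nonneg v M l_sub st_path_nonempty[OF l(1)] cross])
      obtain x where x: "\<forall>l. x l \<ge> 0"
          "\<forall>e\<in>parcs G. (\<Sum>l | l \<in> paths \<and> e \<in> l. x l) \<le> c' e" "sum x paths = v - \<delta>"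
        using less.hyps[of c' "v - \<delta>"] IH_prems M(1) by auto
      \<comment> \<open>The \<delta> units added on \<open>l\<close> use up exactly the capacity
        withheld from its edges.\<close>
      define x' where "x' k = x k + (if k = l then \<delta> else 0)" for k
      have "(\<Sum>k | k \<in> paths \<and> e \<in> k. x' k) \<le> c e" if "e \<in> parcs G" for e
      proof -
        have "(\<Sum>k | k \<in> paths \<and> e \<in> k. x' k) =
            (\<Sum>k | k \<in> paths \<and> e \<in> k. x k) + (if e \<in> l then \<delta> else 0)"
          using finite_st_paths l(1) by (simp add: x'_def sum.distrib)
        also have "\<dots> \<le> c e"
          using x(2) that by (auto simp: c' dest: bspec)
        finally show ?thesis .
      qed
      moreover have "sum x' paths = v"
        using finite_st_paths l(1) x(3) by (simp add: x'_def sum.distrib)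
      moreover have "x' k \<ge> 0" for k
        using x(1) \<delta> by (simp add: x'_def)
      ultimately show ?thesis by blast
    qed
  qed
qed

end

section \<open>Flows and payoffs\<close>

text \<open>Double counting of pairs of an edge and a route through it. The weights used later are
  unit costs, disruption probabilities, and the constant 1, which counts crossings of a cut.\<close>

lemma sum_weighted_incidence:
  fixes w :: "'b \<Rightarrow> real"
  assumes "finite D" "finite L"
  shows "(\<Sum>e\<in>D. w e * (\<Sum>l | l \<in> L \<and> e \<in> l. x l)) = (\<Sum>l\<in>L. sum w (D \<inter> l) * x l)"
proof -
  have "(\<Sum>e\<in>D. w e * (\<Sum>l | l \<in> L \<and> e \<in> l. x l)) =
      (\<Sum>e\<in>D. \<Sum>l\<in>L. if e \<in> l then w e * x l else 0)"
    using assms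
    by (simp add: sum_distrib_left if_distrib[where f = "\<lambda>u. w _ * u"] sum.inter_filter cong: if_cong)
  also have "\<dots> = (\<Sum>l\<in>L. \<Sum>e\<in>D. if e \<in> l then w e * x l else 0)"
    by (rule sum.swap)
  also have "\<dots> = (\<Sum>l\<in>L. sum w (D \<inter> l) * x l)"
    using assms by (simp add: sum_distrib_right Int_def flip: sum.inter_filter)
  finally show ?thesis .
qed

locale interdiction_network = st_digraph G s t for G :: "'a pair_pre_digraph" and s t +
  fixes c b :: "'a edge \<Rightarrow> real"
  assumes capacity_pos: "\<And>e. e \<in> parcs G \<Longrightarrow> c e > 0"
    and cost_pos: "\<And>e. e \<in> parcs G \<Longrightarrow> b e > 0"
    and st_paths_nonempty: "st_paths G s t \<noteq> {}"
begin

abbreviation "routes \<equiv> paths_loops G s t"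
abbreviation "flows \<equiv> feasible_flows G s t c"
abbreviation "path_cost \<equiv> min_path_cost G s t b"

section \<open>Routes and feasible flows\<close>

lemma loop_subset: "l \<in> loops G \<Longrightarrow> l \<subseteq> parcs G"
  by (auto simp: loops_def cycle_def awalk_def)

lemma loop_nonempty: "l \<in> loops G \<Longrightarrow> l \<noteq> {}"
  by (auto simp: loops_def cycle_def)

lemma route_subset: "l \<in> routes \<Longrightarrow> l \<subseteq> parcs G"
  unfolding paths_loops_def using st_path_subset loop_subset by blast

lemma route_nonempty: "l \<in> routes \<Longrightarrow> l \<noteq> {}"
  unfolding paths_loops_def using st_path_nonempty loop_nonempty by blast

lemma finite_routes: "finite routes"
  using pair_finite_arcs by (rule finite_subset[rotated, OF finite_Pow_iff[THEN iffD2]])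
    (auto dest: route_subset)

lemma paths_subset_routes: "paths \<subseteq> routes"
  by (simp add: paths_loops_def)

lemma path_is_route: "l \<in> paths \<Longrightarrow> l \<in> routes"
  by (simp add: paths_loops_def)

lemma route_cost_pos:
  assumes "l \<in> routes"
  shows "sum b l > 0"
  using finite_subset[OF route_subset[OF assms] pair_finite_arcs] route_nonempty[OF assms]
  by (rule sum_pos) (rule cost_pos[OF subsetD[OF route_subset[OF assms]]])

lemma path_cost_le: "l \<in> paths \<Longrightarrow> path_cost \<le> sum b l"
  unfolding min_path_cost_def using finite_st_paths by (intro Min_le finite_imageI imageI)

lemma path_cost_pos: "path_cost > 0"
proof -
  have "path_cost \<in> sum b ` paths"
    unfolding min_path_cost_def using finite_st_paths st_paths_nonempty by (intro Min_in) auto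
  then show ?thesis using route_cost_pos path_is_route by auto
qed

lemma flow_nonneg: "x \<in> flows \<Longrightarrow> l \<in> routes \<Longrightarrow> x l \<ge> 0"
  using PiE_mem[of x routes "\<lambda>_. {0..}" l] by (simp add: feasible_flows_def)

lemma edge_flow_le: "x \<in> flows \<Longrightarrow> e \<in> parcs G \<Longrightarrow> edge_flow G s t x e \<le> c e"
  by (simp add: feasible_flows_def)

text \<open>Every route contains an edge, whose capacity limits its flow. The uniform bound makes
  each coordinate integrable under any mixed strategy, also one of infinite support.\<close>

lemma flow_bounded:
  assumes x: "x \<in> flows" and l: "l \<in> routes"
  shows "\<bar>x l\<bar> \<le> sum c (parcs G)"
proof -
  obtain e where e: "e \<in> l" "e \<in> parcs G" using route_nonempty route_subset l by blast
  have "x l \<le> edge_flow G s t x e"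
    unfolding edge_flow_def using finite_routes l e flow_nonneg[OF x]
    by (intro member_le_sum) auto
  also have "\<dots> \<le> c e" using edge_flow_le x e by simp
  also have "\<dots> \<le> sum c (parcs G)"
    using e pair_finite_arcs capacity_pos by (intro member_le_sum) (auto intro: less_imp_le)
  finally show ?thesis using flow_nonneg[OF x l] by simp
qed

text \<open>All deviations of the router used below arise by decreasing a feasible flow.\<close>

lemma feasible_mono:
  assumes "y \<in> flows" "x \<in> extensional routes"
    and "\<And>l. l \<in> routes \<Longrightarrow> 0 \<le> x l" "\<And>l. l \<in> routes \<Longrightarrow> x l \<le> y l"
  shows "x \<in> flows"
proof -
  have "edge_flow G s t x e \<le> edge_flow G s t y e" for e
    unfolding edge_flow_def using assms(4) by (intro sum_mono) auto
  then have "edge_flow G s t x e \<le> c e" if "e \<in> parcs G" for e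
    using edge_flow_le[OF assms(1) that] by (rule order_trans)
  moreover have "x \<in> routes \<rightarrow>\<^sub>E {0..}"
    using assms(2,3) by (simp add: PiE_def Pi_def)
  ultimately show ?thesis by (simp add: feasible_flows_def)
qed

lemma transport_cost_eq: "transport_cost G s t b x = (\<Sum>l\<in>routes. sum b l * x l)"
proof -
  have "transport_cost G s t b x = (\<Sum>l\<in>routes. sum b (parcs G \<inter> l) * x l)"
    using sum_weighted_incidence[OF pair_finite_arcs finite_routes]
    by (simp add: transport_cost_def edge_flow_def)
  then show ?thesis
    using route_subset by (simp add: Int_absorb1)
qed

section \<open>Duality of flows and cuts\<close>

lemma path_flow_le:
  assumes x: "x \<in> flows" and e: "e \<in> parcs G"
  shows "(\<Sum>l | l \<in> paths \<and> e \<in> l. x l) \<le> c e"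
proof -
  have "(\<Sum>l | l \<in> paths \<and> e \<in> l. x l) \<le> edge_flow G s t x e"
    unfolding edge_flow_def using finite_routes path_is_route flow_nonneg[OF x]
    by (intro sum_mono2) auto
  with edge_flow_le[OF assms] show ?thesis by simp
qed

lemma path_crosses_boundary:
  fixes r :: real
  assumes "l \<in> paths" "S \<in> cuts" "r \<ge> 0"
  shows "r \<le> real (card (boundary S \<inter> l)) * r"
proof -
  have "card (boundary S \<inter> l) \<ge> 1"
    using path_meets_boundary[OF assms(1,2)] finite_boundary
    by (simp add: Suc_le_eq card_gt_0_iff Int_commute)
  then show ?thesis
    using mult_right_mono[of 1 "real (card (boundary S \<inter> l))" r] assms(3) by simp
qed

text \<open>On the right each path counts once per crossing, hence at least once; a path may leave
  and re-enter \<open>S\<close>.\<close>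

lemma path_flow_across_boundary:
  fixes x :: "'a flow"
  assumes S: "S \<in> cuts" and x: "\<And>l. l \<in> paths \<Longrightarrow> x l \<ge> 0"
  shows "sum x paths \<le> (\<Sum>e\<in>boundary S. \<Sum>l | l \<in> paths \<and> e \<in> l. x l)"
proof -
  have "sum x paths \<le> (\<Sum>l\<in>paths. real (card (boundary S \<inter> l)) * x l)"
    by (intro sum_mono path_crosses_boundary S x)
  also have "\<dots> = (\<Sum>e\<in>boundary S. \<Sum>l | l \<in> paths \<and> e \<in> l. x l)"
    using sum_weighted_incidence[of "boundary S" paths "\<lambda>_. 1" x] finite_boundary finite_st_paths
    by simp
  finally show ?thesis .
qed

lemma flow_value_le_cut:
  assumes "x \<in> flows" and "S \<in> cuts"
  shows "flow_value G s t x \<le> sum c (boundary S)"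
proof -
  have "flow_value G s t x \<le> (\<Sum>e\<in>boundary S. \<Sum>l | l \<in> paths \<and> e \<in> l. x l)"
    unfolding flow_value_def using assms flow_nonneg path_is_route
    by (intro path_flow_across_boundary) auto
  also have "\<dots> \<le> sum c (boundary S)"
    using assms(1) by (intro sum_mono path_flow_le) (auto simp: boundary_def)
  finally show ?thesis .
qed

text \<open>Turns weights on paths into a flow without loops. The restriction to
  \<open>routes\<close> supplies the extensionality demanded of feasible flows.\<close>

definition paths_only :: "'a flow \<Rightarrow> 'a flow" where
  "paths_only x = (\<lambda>l\<in>routes. if l \<in> paths then x l else 0)"

lemma paths_only_path [simp]: "l \<in> paths \<Longrightarrow> paths_only x l = x l"
  by (simp add: paths_only_def path_is_route)

lemma edge_flow_paths_only:
  "edge_flow G s t (paths_only x) e = (\<Sum>l | l \<in> paths \<and> e \<in> l. x l)"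
  unfolding edge_flow_def using finite_routes path_is_route
  by (intro sum.mono_neutral_cong_right) (auto simp: paths_only_def)

text \<open>Max-flow min-cut. Exhibiting a flow that meets the cut bound also shows that the value
  defined by \<open>GREATEST\<close> is attained.\<close>

lemma max_flow_value_eq_min_cut:
  assumes S: "S \<in> cuts" and min: "\<And>A. A \<in> cuts \<Longrightarrow> sum c (boundary S) \<le> sum c (boundary A)"
  shows "max_flow_value G s t c = sum c (boundary S)"
proof -
  obtain x :: "'a flow" where x: "\<forall>l. x l \<ge> 0"
      "\<forall>e\<in>parcs G. (\<Sum>l | l \<in> paths \<and> e \<in> l. x l) \<le> c e" "sum x paths = sum c (boundary S)"
    using path_flow_of_min_cut_value[of c "sum c (boundary S)" S] capacity_pos min S
    by (auto intro: less_imp_le)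
  have "paths_only x \<in> flows"
    using x by (auto simp: feasible_flows_def edge_flow_paths_only) (auto simp: paths_only_def)
  moreover have "flow_value G s t (paths_only x) = sum c (boundary S)"
    using x by (simp add: flow_value_def)
  ultimately show ?thesis
    unfolding max_flow_value_def using flow_value_le_cut[OF _ S]
    by (intro Greatest_equality) (auto intro: rev_image_eqI)
qed

section \<open>Expected payoffs through mean flows and disruption probabilities\<close>

definition mean_flow :: "'a flow pmf \<Rightarrow> 'a edge set \<Rightarrow> real" where
  "mean_flow \<sigma> l = measure_pmf.expectation \<sigma> (\<lambda>x. x l)"

definition hit_prob :: "'a attack pmf \<Rightarrow> 'a edge set \<Rightarrow> real" where
  "hit_prob \<sigma> l = measure_pmf.prob \<sigma> {\<mu>. \<exists>e\<in>l. \<mu> e = 1}"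

definition disrupt_prob :: "'a attack pmf \<Rightarrow> 'a edge \<Rightarrow> real" where
  "disrupt_prob \<sigma> e = measure_pmf.prob \<sigma> {\<mu>. \<mu> e = 1}"

lemma finite_attacks: "finite (attacks G)"
  unfolding attacks_def using pair_finite_arcs by (intro finite_PiE) auto

text \<open>Union bound over the edges of \<open>l\<close>.\<close>

lemma hit_prob_le:
  assumes "l \<subseteq> parcs G"
  shows "hit_prob \<sigma> l \<le> (\<Sum>e\<in>l. disrupt_prob \<sigma> e)"
proof -
  have "{\<mu>. \<exists>e\<in>l. \<mu> e = 1} = (\<Union>e\<in>l. {\<mu> :: 'a attack. \<mu> e = 1})" by auto
  then show ?thesis
    unfolding hit_prob_def disrupt_prob_def
    using finite_subset[OF assms pair_finite_arcs]
    by (auto intro!: measure_pmf.finite_measure_subadditive_finite)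
qed

context
  fixes \<sigma>1 assumes \<sigma>1: "\<sigma>1 \<in> mixed_strategies flows"
begin

lemma integrable_flow: "l \<in> routes \<Longrightarrow> integrable (measure_pmf \<sigma>1) (\<lambda>x. x l)"
  using \<sigma>1 flow_bounded
  by (intro measure_pmf.integrable_const_bound[where B = "sum c (parcs G)"])
    (auto simp: AE_measure_pmf_iff mixed_strategies_def)

lemma mean_flow_nonneg: "l \<in> routes \<Longrightarrow> mean_flow \<sigma>1 l \<ge> 0"
  using \<sigma>1 flow_nonneg unfolding mean_flow_def
  by (intro integral_nonneg_AE) (auto simp: AE_measure_pmf_iff mixed_strategies_def)

lemma integrable_linear:
  fixes a :: "'a edge set \<Rightarrow> real"
  assumes "L \<subseteq> routes"
  shows "integrable (measure_pmf \<sigma>1) (\<lambda>x. \<Sum>l\<in>L. a l * x l)"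
  using assms by (intro Bochner_Integration.integrable_sum integrable_mult_right integrable_flow) auto

lemma expectation_linear:
  assumes "L \<subseteq> routes"
  shows "measure_pmf.expectation \<sigma>1 (\<lambda>x. \<Sum>l\<in>L. a l * x l) = (\<Sum>l\<in>L. a l * mean_flow \<sigma>1 l)"
proof -
  have "measure_pmf.expectation \<sigma>1 (\<lambda>x. \<Sum>l\<in>L. a l * x l) =
      (\<Sum>l\<in>L. measure_pmf.expectation \<sigma>1 (\<lambda>x. a l * x l))"
    using assms by (intro Bochner_Integration.integral_sum integrable_mult_right integrable_flow) auto
  then show ?thesis by (simp add: mean_flow_def)
qed

lemma expect_edge_flow:
  "expect \<sigma>1 \<sigma>2 (\<lambda>x \<mu>. edge_flow G s t x e) = (\<Sum>l | l \<in> routes \<and> e \<in> l. mean_flow \<sigma>1 l)"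
  using expectation_linear[of "{l \<in> routes. e \<in> l}" "\<lambda>_. 1"]
  by (simp add: expect_def edge_flow_def)

end

text \<open>A path delivers its flow exactly when it is not hit, so the attack enters through
  indicators of being hit. Integrability is automatic, as there are only finitely many
  attacks.\<close>

lemma expectation_payoff1:
  assumes \<sigma>2: "\<sigma>2 \<in> mixed_strategies (attacks G)"
  shows "measure_pmf.expectation \<sigma>2 (payoff1 G s t b p1 x) =
    p1 * (\<Sum>l\<in>paths. (1 - hit_prob \<sigma>2 l) * x l) - (\<Sum>l\<in>routes. sum b l * x l)"
proof -
  let ?H = "\<lambda>l. {\<mu>. \<exists>e\<in>l. \<mu> e = (1::real)}"
  have "payoff1 G s t b p1 x = (\<lambda>\<mu>.
      p1 * (\<Sum>l\<in>paths. (1 - indicator (?H l) \<mu>) * x l) - (\<Sum>l\<in>routes. sum b l * x l))"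
    unfolding payoff1_def transport_cost_eq flow_value_def effective_flow_def
    using path_is_route by (auto intro!: ext sum.cong simp: indicator_def)
  moreover have "finite (set_pmf \<sigma>2)"
    using \<sigma>2 finite_attacks by (auto simp: mixed_strategies_def intro: finite_subset)
  ultimately show ?thesis
    by (simp add: hit_prob_def integrable_measure_pmf_finite)
qed

lemma expectation_payoff2:
  assumes \<sigma>2: "\<sigma>2 \<in> mixed_strategies (attacks G)"
  shows "measure_pmf.expectation \<sigma>2 (payoff2 G s t c p2 x) =
    p2 * (\<Sum>l\<in>paths. hit_prob \<sigma>2 l * x l) - (\<Sum>e\<in>parcs G. c e * disrupt_prob \<sigma>2 e)"
proof -
  let ?H = "\<lambda>l. {\<mu>. \<exists>e\<in>l. \<mu> e = (1::real)}"
  have "payoff2 G s t c p2 x \<mu> = p2 * (\<Sum>l\<in>paths. indicator (?H l) \<mu> * x l) -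
      (\<Sum>e\<in>parcs G. c e * indicator {\<mu>. \<mu> e = 1} \<mu>)" if "\<mu> \<in> attacks G" for \<mu>
  proof -
    \<comment> \<open>This uses that attacks take only the values 0 and 1, so the identity of
      payoffs holds almost everywhere under \<open>\<sigma>2\<close> rather than for all
      functions.\<close>
    have ind: "\<mu> e = indicator {\<mu>. \<mu> e = 1} \<mu>" if "e \<in> parcs G" for e
      using PiE_mem[of \<mu> "parcs G" "\<lambda>_. {0, 1}" e] \<open>\<mu> \<in> attacks G\<close> that
      by (auto simp: attacks_def)
    have "flow_value G s t (\<lambda>l. x l - effective_flow G s t x \<mu> l) =
        (\<Sum>l\<in>paths. indicator (?H l) \<mu> * x l)"
      unfolding flow_value_def effective_flow_def using path_is_route
      by (intro sum.cong) (auto simp: indicator_def)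
    moreover have "attack_cost G c \<mu> = (\<Sum>e\<in>parcs G. c e * indicator {\<mu>. \<mu> e = 1} \<mu>)"
      unfolding attack_cost_def by (rule sum.cong) (simp_all add: ind[symmetric])
    ultimately show ?thesis by (simp add: payoff2_def)
  qed
  then have "measure_pmf.expectation \<sigma>2 (payoff2 G s t c p2 x) =
      measure_pmf.expectation \<sigma>2 (\<lambda>\<mu>. p2 * (\<Sum>l\<in>paths. indicator (?H l) \<mu> * x l) -
      (\<Sum>e\<in>parcs G. c e * indicator {\<mu>. \<mu> e = 1} \<mu>))"
    using \<sigma>2 by (intro integral_cong_AE) (auto simp: AE_measure_pmf_iff mixed_strategies_def)
  moreover have "finite (set_pmf \<sigma>2)"
    using \<sigma>2 finite_attacks by (auto simp: mixed_strategies_def intro: finite_subset)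
  ultimately show ?thesis
    by (simp add: hit_prob_def disrupt_prob_def integrable_measure_pmf_finite
        del: sum_mult_indicator sum_indicator_mult)
qed

text \<open>After averaging over attacks the payoff is linear in the flow, so
  \<open>\<sigma>1\<close> matters only through its mean.\<close>

lemma expect_payoff1:
  assumes \<sigma>1: "\<sigma>1 \<in> mixed_strategies flows" and \<sigma>2: "\<sigma>2 \<in> mixed_strategies (attacks G)"
  shows "expect \<sigma>1 \<sigma>2 (payoff1 G s t b p1) =
    p1 * (\<Sum>l\<in>paths. (1 - hit_prob \<sigma>2 l) * mean_flow \<sigma>1 l) -
    (\<Sum>l\<in>routes. sum b l * mean_flow \<sigma>1 l)"
  by (simp add: expect_def expectation_payoff1[OF \<sigma>2] paths_subset_routes
      integrable_linear[OF \<sigma>1] expectation_linear[OF \<sigma>1])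

lemma expect_payoff2:
  assumes \<sigma>1: "\<sigma>1 \<in> mixed_strategies flows" and \<sigma>2: "\<sigma>2 \<in> mixed_strategies (attacks G)"
  shows "expect \<sigma>1 \<sigma>2 (payoff2 G s t c p2) =
    p2 * (\<Sum>l\<in>paths. hit_prob \<sigma>2 l * mean_flow \<sigma>1 l) -
    (\<Sum>e\<in>parcs G. c e * disrupt_prob \<sigma>2 e)"
  by (simp add: expect_def expectation_payoff2[OF \<sigma>2] paths_subset_routes
      integrable_linear[OF \<sigma>1] expectation_linear[OF \<sigma>1])

section \<open>Pure deviations from an equilibrium\<close>

definition attack_on :: "'a edge set \<Rightarrow> 'a attack" where
  "attack_on D = (\<lambda>e\<in>parcs G. if e \<in> D then 1 else 0)"

lemma nash_deviation1:
  assumes NE: "(\<sigma>1, \<sigma>2) \<in> nash_equilibria G s t c b p1 p2" and x: "x \<in> flows"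
  shows "p1 * (\<Sum>l\<in>paths. (1 - hit_prob \<sigma>2 l) * x l) - (\<Sum>l\<in>routes. sum b l * x l)
    \<le> expect \<sigma>1 \<sigma>2 (payoff1 G s t b p1)"
proof -
  have "return_pmf x \<in> mixed_strategies flows"
    using x by (simp add: mixed_strategies_def)
  moreover have "\<sigma>2 \<in> mixed_strategies (attacks G)"
    using NE by (simp add: nash_equilibria_def)
  moreover have "expect (return_pmf x) \<sigma>2 (payoff1 G s t b p1)
      \<le> expect \<sigma>1 \<sigma>2 (payoff1 G s t b p1)"
    using NE calculation(1) by (simp add: nash_equilibria_def)
  ultimately show ?thesis
    by (simp add: expect_payoff1 mean_flow_def)
qed

text \<open>The deviation is the pure attack on \<open>D\<close>: it destroys the flow on precisely
  the paths meeting \<open>D\<close> and costs \<open>sum c D\<close>.\<close>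

lemma nash_deviation2:
  assumes NE: "(\<sigma>1, \<sigma>2) \<in> nash_equilibria G s t c b p1 p2" and D: "D \<subseteq> parcs G"
  shows "p2 * (\<Sum>l | l \<in> paths \<and> l \<inter> D \<noteq> {}. mean_flow \<sigma>1 l) - sum c D
    \<le> expect \<sigma>1 \<sigma>2 (payoff2 G s t c p2)"
proof -
  have att: "return_pmf (attack_on D) \<in> mixed_strategies (attacks G)"
    by (auto simp: mixed_strategies_def attacks_def attack_on_def)
  have \<sigma>1: "\<sigma>1 \<in> mixed_strategies flows"
    using NE by (simp add: nash_equilibria_def)
  have "hit_prob (return_pmf (attack_on D)) l = (if l \<inter> D \<noteq> {} then 1 else 0)"
    if "l \<in> paths" for l
  proof -
    have "attack_on D e = 1 \<longleftrightarrow> e \<in> D" if "e \<in> l" for e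
      using subsetD[OF st_path_subset[OF \<open>l \<in> paths\<close>] that] by (simp add: attack_on_def)
    then have "(\<exists>e\<in>l. attack_on D e = 1) \<longleftrightarrow> l \<inter> D \<noteq> {}" by auto
    then show ?thesis by (simp add: hit_prob_def)
  qed
  then have "(\<Sum>l\<in>paths. hit_prob (return_pmf (attack_on D)) l * mean_flow \<sigma>1 l) =
      (\<Sum>l\<in>paths. if l \<inter> D \<noteq> {} then mean_flow \<sigma>1 l else 0)"
    by (intro sum.cong) auto
  also have "\<dots> = (\<Sum>l | l \<in> paths \<and> l \<inter> D \<noteq> {}. mean_flow \<sigma>1 l)"
    using finite_st_paths by (simp only: sum.inter_filter)
  finally have hit: "(\<Sum>l\<in>paths. hit_prob (return_pmf (attack_on D)) l * mean_flow \<sigma>1 l) =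
      (\<Sum>l | l \<in> paths \<and> l \<inter> D \<noteq> {}. mean_flow \<sigma>1 l)" .
  have "(\<Sum>e\<in>parcs G. c e * disrupt_prob (return_pmf (attack_on D)) e) = sum c D"
    using D pair_finite_arcs
    by (intro sum.mono_neutral_cong_right) (auto simp: disrupt_prob_def attack_on_def indicator_def)
  moreover have "expect \<sigma>1 (return_pmf (attack_on D)) (payoff2 G s t c p2)
      \<le> expect \<sigma>1 \<sigma>2 (payoff2 G s t c p2)"
    using NE att by (simp add: nash_equilibria_def)
  ultimately show ?thesis
    by (simp add: expect_payoff2[OF \<sigma>1 att] hit)
qed

end

section \<open>Equilibria\<close>

lemma prob_eq_sum_pmf:
  assumes "finite A" "set_pmf p \<subseteq> A"
  shows "measure_pmf.prob p {x. P x} = (\<Sum>x\<in>{x \<in> A. P x}. pmf p x)"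
proof -
  have "measure_pmf.prob p {x. P x} = measure_pmf.prob p {x \<in> A. P x}"
    using assms(2) by (intro measure_pmf.finite_measure_eq_AE) (auto simp: AE_measure_pmf_iff)
  then show ?thesis
    using assms(1) by (simp add: measure_measure_pmf_finite)
qed

text \<open>
  Scaled, the game is zero-sum: \<open>w\<close> and \<open>u\<close> are the equilibrium payoffs of the
  attacker and (divided by \<open>p1\<close>) of the router, \<open>f\<close> is the mean flow value,
  \<open>h\<close> the mean lost flow, \<open>k\<close> the mean attack cost, \<open>\<theta>\<close> the maximum flow value
  and \<open>\<beta> = 1 - \<alpha> / p1\<close>, \<open>p = p2\<close>. The lower bounds on \<open>u\<close> and \<open>w\<close> come from the four pure
  actions of the saddle point, in the order: no flow, \<open>y\<close>, no attack, attack on the whole cut.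
\<close>

lemma zero_sum_balance:
  fixes \<beta> p \<theta> f h k u w :: real
  assumes \<beta>: "\<beta> > 0" "\<beta> < 1" and p: "p > 1"
    and u: "u \<ge> 0" "u \<ge> \<beta> * \<theta> - k" "u \<le> \<beta> * f - h"
    and w: "w \<ge> 0" "w \<ge> p * f - \<theta>" "w = p * h - k"
  shows "u = 0" "w = 0" "u = \<beta> * f - h" "p * f = \<theta>" "k = \<beta> * \<theta>"
proof -
  \<comment> \<open>Multiplying by \<open>p\<close> makes the lost flow appear as
    \<open>p * h\<close>, which the equation for \<open>w\<close> eliminates.\<close>
  have u_le: "p * u \<le> \<beta> * (p * f) - (w + k)"
    using mult_left_mono[OF u(3), of p] p w(3) by (simp add: algebra_simps)
  have "u \<le> p * u"
    using u(1) p mult_right_mono[of 1 p u] by simp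
  with u_le u(2) have w_le: "w \<le> \<beta> * (p * f - \<theta>)" by (simp add: algebra_simps)
  \<comment> \<open>Now \<open>w\<close> is at least \<open>p * f - \<theta>\<close> and at most
    \<beta> times it. As \<beta> < 1, this number is not positive; as \<open>w\<close> is
    nonnegative and \<beta> > 0, it is not negative either.\<close>
  have "p * f - \<theta> \<le> 0"
  proof (rule ccontr)
    assume "\<not> p * f - \<theta> \<le> 0"
    then have "\<beta> * (p * f - \<theta>) < 1 * (p * f - \<theta>)"
      using \<beta> by (intro mult_strict_right_mono) auto
    with w_le w(2) show False by simp
  qed
  moreover have "0 \<le> \<beta> * (p * f - \<theta>)" using w_le w(1) by simp
  ultimately show f: "p * f = \<theta>" using \<beta> by (simp add: zero_le_mult_iff)
  with w_le w(1) show w0: "w = 0" by simp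
  have pu_le: "p * u \<le> \<beta> * \<theta> - k" using u_le by (simp add: f w0)
  with u(2) have "(p - 1) * u \<le> 0" by (simp add: algebra_simps)
  with u(1) p show u0: "u = 0" by (simp add: mult_le_0_iff)
  with pu_le u(2) show k: "k = \<beta> * \<theta>" by simp
  have "p * (\<beta> * f - h) = 0" using f w(3) by (simp add: w0 k algebra_simps)
  with p u0 show "u = \<beta> * f - h" by simp
qed

context interdiction_network
begin

section \<open>Consequences of equilibrium\<close>

context
  fixes \<sigma>1 :: "'a flow pmf" and \<sigma>2 :: "'a attack pmf" and p1 p2 :: real and S and y :: "'a flow"
  assumes NE: "(\<sigma>1, \<sigma>2) \<in> nash_equilibria G s t c b p1 p2"
    and p1: "p1 > path_cost" and p2: "p2 > 1"
    and S: "S \<in> cuts"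
    and y: "y \<in> flows" "flow_value G s t y = sum c (boundary S)"
      "\<And>l. l \<in> paths \<Longrightarrow> y l > 0 \<Longrightarrow> sum b l = path_cost"
begin

lemma NE_mixed: "\<sigma>1 \<in> mixed_strategies flows" "\<sigma>2 \<in> mixed_strategies (attacks G)"
  using NE by (simp_all add: nash_equilibria_def)

lemma p1_pos: "p1 > 0"
  using p1 path_cost_pos by simp

text \<open>Bound each \<open>hit_prob\<close> by the union bound, exchange the sums, and bound the
  flow of \<open>y\<close> through each edge by its capacity: no attack destroys more of
  \<open>y\<close> than it costs.\<close>

lemma hit_flow_le:
  "(\<Sum>l\<in>paths. hit_prob \<sigma>2 l * y l) \<le> (\<Sum>e\<in>parcs G. c e * disrupt_prob \<sigma>2 e)"
proof -
  have "(\<Sum>l\<in>paths. hit_prob \<sigma>2 l * y l) \<le> (\<Sum>l\<in>paths. sum (disrupt_prob \<sigma>2) (parcs G \<inter> l) * y l)"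
    using y(1) flow_nonneg path_is_route st_path_subset hit_prob_le
    by (intro sum_mono mult_right_mono) (auto simp: Int_absorb1)
  also have "\<dots> = (\<Sum>e\<in>parcs G. disrupt_prob \<sigma>2 e * (\<Sum>l | l \<in> paths \<and> e \<in> l. y l))"
    by (simp add: sum_weighted_incidence pair_finite_arcs finite_st_paths)
  also have "\<dots> \<le> (\<Sum>e\<in>parcs G. disrupt_prob \<sigma>2 e * c e)"
    by (intro sum_mono mult_left_mono path_flow_le y(1)) (simp_all add: disrupt_prob_def)
  finally show ?thesis by (simp add: mult.commute)
qed

text \<open>A path costs at least \<open>path_cost\<close> per unit, a loop more than 0. These
  excesses measure the waste of the router; at equilibrium their sum will vanish, and hence each of
  them.\<close>

lemma excess_cost_nonneg:
  assumes "l \<in> routes"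
  shows "0 \<le> (sum b l - (if l \<in> paths then path_cost else 0)) * mean_flow \<sigma>1 l"
  using assms mean_flow_nonneg[OF NE_mixed(1) assms] path_cost_le[of l] route_cost_pos[of l]
  by simp

lemma sum_excess_cost:
  "(\<Sum>l\<in>routes. (sum b l - (if l \<in> paths then path_cost else 0)) * mean_flow \<sigma>1 l) =
    (\<Sum>l\<in>routes. sum b l * mean_flow \<sigma>1 l) - path_cost * (\<Sum>l\<in>paths. mean_flow \<sigma>1 l)"
proof -
  have "(\<Sum>l\<in>routes. (if l \<in> paths then path_cost else 0) * mean_flow \<sigma>1 l) =
      (\<Sum>l\<in>paths. path_cost * mean_flow \<sigma>1 l)"
    using finite_routes paths_subset_routes by (intro sum.mono_neutral_cong_right) auto
  then show ?thesis
    by (simp add: left_diff_distrib sum_subtractf sum_distrib_left)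
qed

text \<open>The four pure actions of the saddle point bound the equilibrium payoffs from below,
  excess costs bound the payoff of the router from above, and \<open>zero_sum_balance\<close> turns
  all bounds into equalities.\<close>

lemma equilibrium_values:
  shows equilibrium_payoff1: "expect \<sigma>1 \<sigma>2 (payoff1 G s t b p1) = 0"
    and equilibrium_payoff2: "expect \<sigma>1 \<sigma>2 (payoff2 G s t c p2) = 0"
    and mean_flow_value: "p2 * (\<Sum>l\<in>paths. mean_flow \<sigma>1 l) = sum c (boundary S)"
    and mean_transport_cost: "(\<Sum>l\<in>routes. sum b l * mean_flow \<sigma>1 l) =
      path_cost * (\<Sum>l\<in>paths. mean_flow \<sigma>1 l)"
    and mean_attack_cost: "(\<Sum>e\<in>parcs G. c e * disrupt_prob \<sigma>2 e) =
      (1 - path_cost / p1) * sum c (boundary S)"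
proof -
  define f where "f = (\<Sum>l\<in>paths. mean_flow \<sigma>1 l)"
  define h where "h = (\<Sum>l\<in>paths. hit_prob \<sigma>2 l * mean_flow \<sigma>1 l)"
  define k where "k = (\<Sum>e\<in>parcs G. c e * disrupt_prob \<sigma>2 e)"
  define C where "C = (\<Sum>l\<in>routes. sum b l * mean_flow \<sigma>1 l)"
  \<comment> \<open>Division by \<open>p1\<close> gives the lost flow coefficient -1; \<beta> is
    then the scaled profit per undisrupted unit on a cheapest path.\<close>
  define u where "u = expect \<sigma>1 \<sigma>2 (payoff1 G s t b p1) / p1"
  define w where "w = expect \<sigma>1 \<sigma>2 (payoff2 G s t c p2)"
  define \<theta> where "\<theta> = sum c (boundary S)"
  define \<beta> where "\<beta> = 1 - path_cost / p1"
  have payoff1: "p1 * u = p1 * (f - h) - C"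
    using p1_pos by (simp add: u_def expect_payoff1[OF NE_mixed] f_def h_def C_def
        left_diff_distrib sum_subtractf)
  have w: "w = p2 * h - k"
    by (simp add: w_def expect_payoff2[OF NE_mixed] h_def k_def)
  have \<beta>: "\<beta> > 0" "\<beta> < 1" "p1 * \<beta> = p1 - path_cost"
    using p1 p1_pos path_cost_pos by (simp_all add: \<beta>_def field_simps)
  have "0 \<le> (\<Sum>l\<in>routes. (sum b l - (if l \<in> paths then path_cost else 0)) * mean_flow \<sigma>1 l)"
    using excess_cost_nonneg by (rule sum_nonneg)
  then have "path_cost * f \<le> C"
    unfolding sum_excess_cost f_def C_def by simp
  then have "p1 * u \<le> p1 * (\<beta> * f - h)"
    using arg_cong[OF \<beta>(3), of "\<lambda>r. r * f"] by (simp add: payoff1 algebra_simps)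
  then have u_le: "u \<le> \<beta> * f - h" using p1_pos by simp
  have "(\<lambda>l\<in>routes. 0) \<in> flows"
    by (rule feasible_mono[OF y(1)]) (use flow_nonneg[OF y(1)] in auto)
  from nash_deviation1[OF NE this] have "expect \<sigma>1 \<sigma>2 (payoff1 G s t b p1) \<ge> 0"
    using path_is_route by simp
  then have u_nonneg: "u \<ge> 0" using p1_pos by (simp add: u_def)
  \<comment> \<open>The conditions on \<open>y\<close> concern only paths, so its loops are dropped
    before its cost is computed.\<close>
  have y': "paths_only y \<in> flows"
    using flow_nonneg[OF y(1)] by (intro feasible_mono[OF y(1)]) (auto simp: paths_only_def)
  have "(\<Sum>l\<in>routes. sum b l * paths_only y l) = (\<Sum>l\<in>paths. path_cost * y l)"
  proof (rule sum.mono_neutral_cong_right)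
    fix l assume l: "l \<in> paths"
    then show "sum b l * paths_only y l = path_cost * y l"
      using y(3)[OF l] flow_nonneg[OF y(1) path_is_route[OF l]] by (cases "y l = 0") auto
  qed (use finite_routes paths_subset_routes in \<open>auto simp: paths_only_def\<close>)
  also have "\<dots> = path_cost * \<theta>"
    using y(2) by (simp add: \<theta>_def flow_value_def flip: sum_distrib_left)
  finally have cost_y: "(\<Sum>l\<in>routes. sum b l * paths_only y l) = path_cost * \<theta>" .
  have "(\<Sum>l\<in>paths. (1 - hit_prob \<sigma>2 l) * paths_only y l) = \<theta> - (\<Sum>l\<in>paths. hit_prob \<sigma>2 l * y l)"
    using y(2) by (simp add: left_diff_distrib sum_subtractf \<theta>_def flow_value_def)
  with nash_deviation1[OF NE y'] cost_y
  have "p1 * (\<theta> - (\<Sum>l\<in>paths. hit_prob \<sigma>2 l * y l)) - path_cost * \<theta> \<le> p1 * u"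
    using p1_pos by (simp add: u_def)
  moreover have "p1 * (\<theta> - k) \<le> p1 * (\<theta> - (\<Sum>l\<in>paths. hit_prob \<sigma>2 l * y l))"
    using hit_flow_le p1_pos by (simp add: k_def)
  ultimately have "p1 * (\<beta> * \<theta> - k) \<le> p1 * u"
    using arg_cong[OF \<beta>(3), of "\<lambda>r. r * \<theta>"] by (simp add: algebra_simps)
  then have u_ge: "u \<ge> \<beta> * \<theta> - k" using p1_pos by simp
  have w_nonneg: "w \<ge> 0"
    using nash_deviation2[OF NE, of "{}"] by (simp add: w_def)
  have "{l \<in> paths. l \<inter> boundary S \<noteq> {}} = paths"
    using path_meets_boundary[OF _ S] by auto
  then have w_ge: "w \<ge> p2 * f - \<theta>"
    using nash_deviation2[OF NE boundary_subset[of S]] by (simp add: w_def f_def \<theta>_def)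
  note balance = zero_sum_balance[OF \<beta>(1,2) p2 u_nonneg u_ge u_le w_nonneg w_ge w]
  show "expect \<sigma>1 \<sigma>2 (payoff1 G s t b p1) = 0"
    using balance(1) p1_pos by (simp add: u_def)
  show "expect \<sigma>1 \<sigma>2 (payoff2 G s t c p2) = 0"
    using balance(2) by (simp add: w_def)
  show "p2 * (\<Sum>l\<in>paths. mean_flow \<sigma>1 l) = sum c (boundary S)"
    using balance(4) by (simp add: f_def \<theta>_def)
  show "(\<Sum>e\<in>parcs G. c e * disrupt_prob \<sigma>2 e) = (1 - path_cost / p1) * sum c (boundary S)"
    using balance(5) by (simp add: k_def \<theta>_def \<beta>_def)
  have "C = p1 * (f - h)" using payoff1 balance(1) by simp
  also have "\<dots> = path_cost * f"
    using balance(1,3) arg_cong[OF \<beta>(3), of "\<lambda>r. r * f"]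
    by (simp add: right_diff_distrib mult.assoc left_diff_distrib)
  finally show "(\<Sum>l\<in>routes. sum b l * mean_flow \<sigma>1 l) = path_cost * (\<Sum>l\<in>paths. mean_flow \<sigma>1 l)"
    by (simp add: C_def f_def)
qed

text \<open>The nonnegative excess costs sum to 0, so each is 0, and the excess per unit of a loop
  is its positive cost.\<close>

lemma mean_loop_flow_zero:
  assumes "l \<in> routes" "l \<notin> paths"
  shows "mean_flow \<sigma>1 l = 0"
proof -
  have "(\<Sum>l\<in>routes. (sum b l - (if l \<in> paths then path_cost else 0)) * mean_flow \<sigma>1 l) = 0"
    by (simp add: sum_excess_cost mean_transport_cost)
  from sum_nonneg_0[OF finite_routes excess_cost_nonneg this assms(1)]
  have "(sum b l - (if l \<in> paths then path_cost else 0)) * mean_flow \<sigma>1 l = 0" .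
  then show ?thesis using assms route_cost_pos[OF assms(1)] by simp
qed

text \<open>An attack on \<open>e\<close> alone earns at most the equilibrium payoff 0, which bounds
  the mean path flow through \<open>e\<close> by \<open>c e / p2\<close>. Over the cut these flows
  add up to at least the mean flow value, which is the sum of the bounds, so every bound is
  attained. Loops add nothing.\<close>

lemma mean_edge_flow_on_min_cut:
  assumes e: "e \<in> boundary S"
  shows "expect \<sigma>1 \<sigma>2 (\<lambda>x \<mu>. edge_flow G s t x e) = c e / p2"
proof -
  let ?m = "\<lambda>e. \<Sum>l | l \<in> paths \<and> e \<in> l. mean_flow \<sigma>1 l"
  have le: "?m e \<le> c e / p2" if "e \<in> boundary S" for e
  proof -
    have "{l \<in> paths. l \<inter> {e} \<noteq> {}} = {l \<in> paths. e \<in> l}" by auto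
    then have "p2 * ?m e - c e \<le> 0"
      using nash_deviation2[OF NE, of "{e}"] that boundary_subset[of S] equilibrium_payoff2 by auto
    then show ?thesis using p2 by (simp add: field_simps)
  qed
  have "(\<Sum>e\<in>boundary S. c e / p2) = (\<Sum>l\<in>paths. mean_flow \<sigma>1 l)"
    using mean_flow_value p2 by (simp add: field_simps flip: sum_divide_distrib)
  also have "\<dots> \<le> sum ?m (boundary S)"
    using mean_flow_nonneg[OF NE_mixed(1)] path_is_route
    by (intro path_flow_across_boundary[OF S]) auto
  finally have "(\<Sum>e\<in>boundary S. c e / p2) \<le> sum ?m (boundary S)" .
  moreover have "sum ?m (boundary S) \<le> (\<Sum>e\<in>boundary S. c e / p2)"
    using le by (rule sum_mono)
  ultimately have "sum ?m (boundary S) = (\<Sum>e\<in>boundary S. c e / p2)"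
    by (rule antisym[rotated])
  from sum_mono_inv[OF this le e finite_boundary] have "?m e = c e / p2" .
  moreover have "(\<Sum>l | l \<in> routes \<and> e \<in> l. mean_flow \<sigma>1 l) = ?m e"
    using finite_routes path_is_route mean_loop_flow_zero
    by (intro sum.mono_neutral_right) auto
  ultimately show ?thesis
    using expect_edge_flow[OF NE_mixed(1), of \<sigma>2 e] by simp
qed

text \<open>Sending only \<open>y l\<close> units along \<open>l\<close> must not earn more than the
  equilibrium payoff 0, so the expected revenue per unit,
  \<open>p1 * (1 - hit_prob \<sigma>2 l)\<close>, is at most the unit cost
  \<open>path_cost\<close>.\<close>

lemma hit_prob_ge:
  assumes l: "l \<in> paths" "y l > 0"
  shows "1 - path_cost / p1 \<le> hit_prob \<sigma>2 l"
proof -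
  define x where "x = (\<lambda>k\<in>routes. if k = l then y l else 0)"
  have x_eq: "x k = (if k = l then y l else 0)" if "k \<in> routes" for k
    using that by (simp add: x_def)
  have "x \<in> flows"
    using flow_nonneg[OF y(1)] by (intro feasible_mono[OF y(1)]) (auto simp: x_def)
  moreover have "(\<Sum>k\<in>paths. (1 - hit_prob \<sigma>2 k) * x k) = (1 - hit_prob \<sigma>2 l) * y l"
  proof -
    have "(\<Sum>k\<in>paths. (1 - hit_prob \<sigma>2 k) * x k) =
        (\<Sum>k\<in>paths. if k = l then (1 - hit_prob \<sigma>2 l) * y l else 0)"
      using path_is_route by (intro sum.cong) (auto simp: x_eq)
    then show ?thesis using finite_st_paths l by simp
  qed
  moreover have "(\<Sum>k\<in>routes. sum b k * x k) = path_cost * y l"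
  proof -
    have "(\<Sum>k\<in>routes. sum b k * x k) = (\<Sum>k\<in>routes. if k = l then path_cost * y l else 0)"
      using y(3) l by (intro sum.cong) (auto simp: x_eq)
    then show ?thesis using finite_routes l path_is_route by simp
  qed
  ultimately have "p1 * ((1 - hit_prob \<sigma>2 l) * y l) - path_cost * y l \<le> 0"
    using nash_deviation1[OF NE] equilibrium_payoff1 by metis
  then have "(p1 * (1 - hit_prob \<sigma>2 l) - path_cost) * y l \<le> 0"
    by (simp add: algebra_simps)
  then have "p1 * (1 - hit_prob \<sigma>2 l) \<le> path_cost"
    using l(2) by (simp add: mult_le_0_iff)
  then show ?thesis using p1_pos by (simp add: field_simps)
qed

text \<open>Complementary slackness between the maximum flow and the minimum cut.\<close>

lemma flow_carrying_path_through_cut_edge: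
  assumes e: "e \<in> boundary S"
  obtains l where "l \<in> paths" "y l > 0" "l \<inter> boundary S = {e}"
proof -
  let ?through = "\<lambda>e. \<Sum>l | l \<in> paths \<and> e \<in> l. y l"
  have through_le: "?through e \<le> c e" if "e \<in> boundary S" for e
    using that boundary_subset by (intro path_flow_le[OF y(1)]) auto
  have y_nonneg: "y l \<ge> 0" if "l \<in> paths" for l
    using flow_nonneg[OF y(1)] path_is_route that by simp
  have "sum y paths \<le> sum ?through (boundary S)"
    using y_nonneg by (rule path_flow_across_boundary[OF S])
  moreover have "sum ?through (boundary S) \<le> sum c (boundary S)"
    using through_le by (rule sum_mono)
  ultimately have through_sum: "sum ?through (boundary S) = sum c (boundary S)"
    using y(2) by (simp add: flow_value_def)
  have "?through e = c e"
    using sum_mono_inv[OF through_sum through_le e finite_boundary] .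
  then have "?through e > 0"
    using capacity_pos[of e] e boundary_subset[of S] by auto
  then obtain l where l: "l \<in> paths" "e \<in> l" "y l > 0"
    using sum_nonpos[of "{l \<in> paths. e \<in> l}" y] by (force simp: not_le)
  have count_ge: "y l \<le> real (card (boundary S \<inter> l)) * y l" if "l \<in> paths" for l
    using that S y_nonneg[OF that] by (rule path_crosses_boundary)
  \<comment> \<open>Saturation of the cut gives equality in the crossing count, so a path carrying
    flow crosses exactly once.\<close>
  have "sum y paths = (\<Sum>l\<in>paths. real (card (boundary S \<inter> l)) * y l)"
    using sum_weighted_incidence[of "boundary S" paths "\<lambda>_. 1" y] finite_boundary finite_st_paths
      through_sum y(2) by (simp add: flow_value_def)
  from sum_mono_inv[OF this count_ge l(1) finite_st_paths] have "card (boundary S \<inter> l) = 1"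
    using l(3) by simp
  then obtain k where k: "boundary S \<inter> l = {k}" by (rule card_1_singletonE)
  have "e \<in> boundary S \<inter> l" using e l(2) by simp
  with k have "l \<inter> boundary S = {e}" by (simp add: Int_commute)
  with l that show thesis by blast
qed

text \<open>Some flow-carrying path meets the cut only in \<open>e\<close>, and its other edges are
  never disrupted, so \<open>hit_prob_ge\<close> bounds \<open>disrupt_prob \<sigma>2 e\<close> from
  below. Weighted by capacities, these bounds sum to the mean attack cost, so each is an
  equality.\<close>

lemma disrupt_prob_on_min_cut:
  assumes only_cut: "\<And>\<mu> e. \<mu> \<in> set_pmf \<sigma>2 \<Longrightarrow> e \<in> parcs G \<Longrightarrow> \<mu> e = 1 \<Longrightarrow> e \<in> boundary S"
    and e: "e \<in> boundary S"
  shows "disrupt_prob \<sigma>2 e = 1 - path_cost / p1"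
proof -
  have zero: "disrupt_prob \<sigma>2 e = 0" if "e \<in> parcs G - boundary S" for e
    using that only_cut[of _ e] unfolding disrupt_prob_def
    by (subst measure_pmf.prob_eq_0) (auto simp: AE_measure_pmf_iff simp del: split_paired_All)
  have ge: "1 - path_cost / p1 \<le> disrupt_prob \<sigma>2 e" if e: "e \<in> boundary S" for e
  proof -
    obtain l where l: "l \<in> paths" "y l > 0" "l \<inter> boundary S = {e}"
      using flow_carrying_path_through_cut_edge[OF e] .
    have "1 - path_cost / p1 \<le> hit_prob \<sigma>2 l" using hit_prob_ge l by simp
    also have "\<dots> \<le> (\<Sum>e\<in>l. disrupt_prob \<sigma>2 e)"
      using hit_prob_le st_path_subset[OF l(1)] by simp
    also have "\<dots> = (\<Sum>e\<in>{e}. disrupt_prob \<sigma>2 e)"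
      using l(3) st_path_subset[OF l(1)] finite_st_path[OF l(1)] zero
      by (intro sum.mono_neutral_right) auto
    finally show ?thesis by simp
  qed
  have cap_ge: "c e * (1 - path_cost / p1) \<le> c e * disrupt_prob \<sigma>2 e" if "e \<in> boundary S" for e
    using ge[OF that] capacity_pos[of e] that boundary_subset[of S]
    by (intro mult_left_mono) auto
  have "(\<Sum>e\<in>boundary S. c e * (1 - path_cost / p1)) = (\<Sum>e\<in>parcs G. c e * disrupt_prob \<sigma>2 e)"
    unfolding mean_attack_cost by (simp add: mult.commute flip: sum_distrib_right)
  also have "\<dots> = (\<Sum>e\<in>boundary S. c e * disrupt_prob \<sigma>2 e)"
    using pair_finite_arcs boundary_subset zero by (intro sum.mono_neutral_right) auto
  finally have "c e * (1 - path_cost / p1) = c e * disrupt_prob \<sigma>2 e"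
    using cap_ge e finite_boundary by (rule sum_mono_inv)
  then show ?thesis
    using capacity_pos[of e] e boundary_subset[of S] by auto
qed

end

end

theorem proposition5:
  fixes G :: "'a pair_pre_digraph"
    and s t :: 'a
    and c b :: "'a \<times> 'a \<Rightarrow> real"
    and p1 p2 :: real
    and S T :: "'a set"
  assumes "pair_fin_digraph G"
    and "s \<in> pverts G" and "t \<in> pverts G" and "t \<noteq> s"
    and "st_paths G s t \<noteq> {}"
    and "\<And>e. e \<in> parcs G \<Longrightarrow> c e > 0"
    and "\<And>e. e \<in> parcs G \<Longrightarrow> b e > 0"
    and "p1 > 0" and "p2 > 0"
    and "min_cost_paths_assumption G s t c b"
    and "p1 > min_path_cost G s t b"
    and "p2 > 1"
    and "min_st_cut G s t c (S, T)"
  shows "(\<forall>(\<sigma>1, \<sigma>2) \<in> nash_equilibria G s t c b p1 p2. \<forall>e \<in> cut_set G (S, T).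
            expect \<sigma>1 \<sigma>2 (\<lambda>x \<mu>. edge_flow G s t x e) = c e / p2) \<and>
         (\<forall>(\<sigma>1, \<sigma>2) \<in> nash_equilibria G s t c b p1 p2.
            (\<forall>\<mu> \<in> set_pmf \<sigma>2. \<forall>e \<in> parcs G. \<mu> e = 1 \<longrightarrow> e \<in> cut_set G (S, T)) \<longrightarrow>
            (\<forall>e \<in> cut_set G (S, T).
               (\<Sum>\<mu> \<in> {\<mu> \<in> attacks G. \<mu> e = 1}. pmf \<sigma>2 \<mu>) = 1 - min_path_cost G s t b / p1))"
proof -
  interpret pair_fin_digraph G by (rule assms(1))
  interpret interdiction_network G s t c b
    by unfold_locales (use assms in simp_all)
  have cut_set_eq: "cut_set G (A, B) = boundary A" for A B
    by (auto simp: cut_set_def boundary_def)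
  have S: "S \<in> cuts" and S_min: "sum c (boundary S) \<le> sum c (boundary A)" if "A \<in> cuts" for A
  proof -
    show "S \<in> cuts"
      using assms(13) by (auto simp: min_st_cut_def is_arg_min_def st_cut_def cuts_def)
    have "st_cut G s t (A, pverts G - A)"
      using that sink by (auto simp: st_cut_def cuts_def)
    then show "sum c (boundary S) \<le> sum c (boundary A)"
      using assms(13) by (force simp: min_st_cut_def is_arg_min_def cut_set_eq not_less)
  qed
  \<comment> \<open>Both facts were derived under \<open>A \<in> cuts\<close>; the cut
    \<open>{s}\<close> discharges this for the first.\<close>
  note S = S[OF source_cut]
  \<comment> \<open>The flow from Assumption 1; its value is the capacity of the given cut by
    max-flow min-cut.\<close>
  obtain y where y: "y \<in> flows" "flow_value G s t y = sum c (boundary S)"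
      "\<And>l. l \<in> paths \<Longrightarrow> y l > 0 \<Longrightarrow> sum b l = path_cost"
    using assms(10) max_flow_value_eq_min_cut[OF S S_min]
    unfolding min_cost_paths_assumption_def min_cost_max_flows_def is_arg_min_def by auto
  show ?thesis
  proof (intro conjI ballI; clarify)
    fix \<sigma>1 \<sigma>2 i j
    assume NE: "(\<sigma>1, \<sigma>2) \<in> nash_equilibria G s t c b p1 p2" and "(i, j) \<in> cut_set G (S, T)"
    then show "expect \<sigma>1 \<sigma>2 (\<lambda>x \<mu>. edge_flow G s t x (i, j)) = c (i, j) / p2"
      using mean_edge_flow_on_min_cut[OF NE assms(11,12) S y] by (simp add: cut_set_eq)
  next
    fix \<sigma>1 \<sigma>2 i j
    assume NE: "(\<sigma>1, \<sigma>2) \<in> nash_equilibria G s t c b p1 p2"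
      and only_cut: "\<forall>\<mu>\<in>set_pmf \<sigma>2. \<forall>e\<in>parcs G. \<mu> e = 1 \<longrightarrow> e \<in> cut_set G (S, T)"
      and e: "(i, j) \<in> cut_set G (S, T)"
    have "set_pmf \<sigma>2 \<subseteq> attacks G"
      using NE by (simp add: nash_equilibria_def mixed_strategies_def)
    then have "(\<Sum>\<mu>\<in>{\<mu> \<in> attacks G. \<mu> (i, j) = 1}. pmf \<sigma>2 \<mu>) = disrupt_prob \<sigma>2 (i, j)"
      unfolding disrupt_prob_def by (rule prob_eq_sum_pmf[OF finite_attacks, symmetric])
    also have "\<dots> = 1 - path_cost / p1"
      by (rule disrupt_prob_on_min_cut[OF NE assms(11,12) S y])
        (use only_cut e in \<open>auto simp: cut_set_eq\<close>)
    finally show "(\<Sum>\<mu>\<in>{\<mu> \<in> attacks G. \<mu> (i, j) = 1}. pmf \<sigma>2 \<mu>) = 1 - path_cost / p1" .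
  qed
qed

end
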